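(* Let $(X,X_+,\mathcal K,f)$ be an abstract state space, $P$ a projection on $X$, and $T\in\Sigma_P(X)$ such that $TP$ is quasi-compact on $X$. If there exists $n_0\in\mathbb N$ such that $\delta_P(T^{n_0})<1$, then $T$ is quasi-compact.
   Context: Let $X$ be a real ordered vector space with generating cone $X_+$ ($X=X_+-X_+$), let $f$ be a strictly positive linear functional on $X$ ($f(x)>0$ for $x>0$), and let $\mathcal K=\{x\in X_+: f(x)=1\}$. Let $U$ be the convex hull of $\mathcal K\cup(-\mathcal K)$ and $\|x\|=\inf\{t\ge 0: x\in tU\}$. $(X,X_+,\mathcal K,f)$ is an abstract state space if this seminorm is a norm, $X$ is complete for it, and $X_+$ is closed; $X$ always carries this norm. A linear operator $T:X\to X$ is Markov if it is positive and $T(\mathcal K)\subset\mathcal K$; $\Sigma(X)$ is the set of Markov operators. A projection is a bounded linear operator $P:X\to X$ with $P^2=P$; $\Sigma_P(X)=\{T\in\Sigma(X): TP=PT\}$. For a bounded linear operator $T$, $\delta_P(T)=\sup\{\|Tx\|/\|x\| : Px=0,\ x\ne0\}$ if $P\ne I$, and $\delta_I(T)=1$ by convention. $\mathbb N=\{1,2,\dots\}$. A bounded linear operator $A$ on a Banach space is quasi-compact if there exist $m\in\mathbb N$ and a compact operator $K$ with $\|A^{m}-K\|<1$. *)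

theory Defs
  imports "HOL-Analysis.Analysis"
begin

definition state_base :: "('a::ordered_real_vector \<Rightarrow> real) \<Rightarrow> 'a set" where
  "state_base f = {x. 0 \<le> x \<and> f x = 1}"

definition base_seminorm :: "('a::ordered_real_vector \<Rightarrow> real) \<Rightarrow> 'a \<Rightarrow> real" where
  "base_seminorm f x =
     Inf {t. 0 \<le> t \<and> x \<in> (\<lambda>u. t *\<^sub>R u) ` (convex hull (state_base f \<union> uminus ` state_base f))}"

(* The ordered vector space is the type itself, with cone {x. 0 \<le> x}. Requiring the type's norm to
   be the base seminorm says that the latter is a norm; completeness is supplied by the class
   banach, and the topology in which the cone is closed is that of this norm. *)
definition abstract_state_space :: "('a::{banach,ordered_real_vector} \<Rightarrow> real) \<Rightarrow> bool" where
  "abstract_state_space f \<longleftrightarrow>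
     (\<forall>x::'a. \<exists>y z. 0 \<le> y \<and> 0 \<le> z \<and> x = y - z) \<and>
     linear f \<and> (\<forall>x>0. 0 < f x) \<and>
     (\<forall>x. norm x = base_seminorm f x) \<and>
     closed {x::'a. 0 \<le> x}"

definition markov :: "('a::ordered_real_vector \<Rightarrow> real) \<Rightarrow> ('a \<Rightarrow> 'a) \<Rightarrow> bool" where
  "markov f T \<longleftrightarrow> linear T \<and> (\<forall>x\<ge>0. 0 \<le> T x) \<and> T ` state_base f \<subseteq> state_base f"

definition is_projection :: "('a::real_normed_vector \<Rightarrow> 'a) \<Rightarrow> bool" where
  "is_projection P \<longleftrightarrow> bounded_linear P \<and> P \<circ> P = P"

definition markov_commuting ::
    "('a::{real_normed_vector,ordered_real_vector} \<Rightarrow> real) \<Rightarrow> ('a \<Rightarrow> 'a) \<Rightarrow> ('a \<Rightarrow> 'a) set" where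
  "markov_commuting f P = {T. markov f T \<and> T \<circ> P = P \<circ> T}"

(* Intended for bounded linear T and a projection P: if P is not the identity, the set is then
   nonempty and bounded above. *)
definition ergodicity_coeff ::
    "('a::real_normed_vector \<Rightarrow> 'a) \<Rightarrow> ('a \<Rightarrow> 'a) \<Rightarrow> real" where
  "ergodicity_coeff P T =
     (if P = id then 1 else Sup {norm (T x) / norm x | x. P x = 0 \<and> x \<noteq> 0})"

definition compact_operator ::
    "('a::real_normed_vector \<Rightarrow> 'b::real_normed_vector) \<Rightarrow> bool" where
  "compact_operator K \<longleftrightarrow> bounded_linear K \<and> compact (closure (K ` cball 0 1))"

definition quasi_compact :: "('a::real_normed_vector \<Rightarrow> 'a) \<Rightarrow> bool" where
  "quasi_compact A \<longleftrightarrow> bounded_linear A \<and>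
     (\<exists>m\<ge>1. \<exists>K. compact_operator K \<and> onorm (\<lambda>x. (A ^^ m) x - K x) < 1)"

end

theory Submission
  imports Defs
begin

text \<open>
  Split \<open>T ^ N = T ^ N P + T ^ N (I - P)\<close>. Since \<open>T\<close> commutes with \<open>P\<close>, it leaves the
  kernel of \<open>P\<close>, which is the range of \<open>I - P\<close>, invariant. So \<open>\<delta> (T ^ n0) < 1\<close> makes
  \<open>T ^ (n0 k) (I - P)\<close> decay geometrically in \<open>k\<close>
  (\<open>funpow_contracts_invariant\<close>). On the other part, \<open>T ^ N P = (T P) ^ N\<close>, and if
  \<open>(T P) ^ m - K\<close> has norm \<open>a < 1\<close> with \<open>K\<close> compact, then expanding
  \<open>((T P) ^ m - K) ^ j\<close> shows that \<open>(T P) ^ (m j)\<close> lies within \<open>a ^ j\<close> of a compact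
  operator, because the compact operators form a two-sided ideal
  (\<open>quasi_compact_powers_near_compact\<close>). Along the common exponents \<open>N = m n0 j\<close> both
  errors tend to \<open>0\<close>, so that some \<open>T ^ N\<close> has distance less than \<open>1\<close> from a compact
  operator.

  The order structure enters only through the boundedness of \<open>T\<close>: a Markov operator maps the
  convex hull \<open>U\<close> of the states and their negatives into itself, hence does not increase the
  gauge of \<open>U\<close> (\<open>markov_norm_le\<close>). In particular the supremum defining
  \<open>\<delta> (T ^ n0)\<close> is over a bounded set, so that it really bounds \<open>T ^ n0\<close> on the kernel.
\<close>

section \<open>Compact operators form an ideal\<close>

lemma compact_operatorI:
  assumes "bounded_linear K" "compact C" "K ` cball 0 1 \<subseteq> C"
  shows "compact_operator K"
proof -
  have "closure (K ` cball 0 1) \<subseteq> C"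
    using assms by (simp add: closure_minimal compact_imp_closed)
  then have "compact (closure (K ` cball 0 1))"
    using compact_Int_closed[OF assms(2) closed_closure, of "K ` cball 0 1"]
    by (simp add: Int_absorb1)
  then show ?thesis
    using assms by (simp add: compact_operator_def)
qed

lemma compact_operator_zero: "compact_operator (\<lambda>x. 0)"
  by (rule compact_operatorI[of _ "{0}"]) (auto simp: bounded_linear_zero)

lemma compact_operator_add:
  assumes "compact_operator K" "compact_operator L"
  shows "compact_operator (\<lambda>x. K x + L x)"
proof (rule compact_operatorI)
  let ?C = "{x + y | x y. x \<in> closure (K ` cball 0 1) \<and> y \<in> closure (L ` cball 0 1)}"
  show "bounded_linear (\<lambda>x. K x + L x)"
    using assms by (simp add: compact_operator_def bounded_linear_add)
  show "compact ?C"
    using assms by (intro compact_sums) (auto simp: compact_operator_def)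
  show "(\<lambda>x. K x + L x) ` cball 0 1 \<subseteq> ?C"
    using closure_subset[of "K ` cball 0 1"] closure_subset[of "L ` cball 0 1"] by blast
qed

lemma compact_operator_compose_left:
  assumes "bounded_linear B" "compact_operator K"
  shows "compact_operator (\<lambda>x. B (K x))"
proof (rule compact_operatorI)
  show "bounded_linear (\<lambda>x. B (K x))"
    using assms by (simp add: compact_operator_def bounded_linear_compose)
  show "compact (B ` closure (K ` cball 0 1))"
    using assms by (intro compact_continuous_image linear_continuous_on)
      (auto simp: compact_operator_def)
  show "(\<lambda>x. B (K x)) ` cball 0 1 \<subseteq> B ` closure (K ` cball 0 1)"
    using closure_subset[of "K ` cball 0 1"] by blast
qed

lemma compact_operator_compose_right:
  assumes "compact_operator K" "bounded_linear B"
  shows "compact_operator (\<lambda>x. K (B x))"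
proof -
  have K: "bounded_linear K"
    using assms by (simp add: compact_operator_def)
  obtain b where b: "b > 0" "\<And>x. norm (B x) \<le> norm x * b"
    using bounded_linear.pos_bounded[OF assms(2)] by blast
  show ?thesis
  proof (rule compact_operatorI)
    show "bounded_linear (\<lambda>x. K (B x))"
      using K assms(2) by (rule bounded_linear_compose)
    show "compact ((*\<^sub>R) b ` closure (K ` cball 0 1))"
      using assms by (simp add: compact_scaling compact_operator_def)
    show "(\<lambda>x. K (B x)) ` cball 0 1 \<subseteq> (*\<^sub>R) b ` closure (K ` cball 0 1)"
    proof
      fix y assume "y \<in> (\<lambda>x. K (B x)) ` cball 0 1"
      then obtain x where x: "norm x \<le> 1" "y = K (B x)" by auto
      have "norm (B x) \<le> b"
        using order_trans[OF b(2) mult_right_mono[OF x(1), of b]] b(1) by simp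
      then have "(1 / b) *\<^sub>R B x \<in> cball 0 1"
        using b(1) by (simp add: divide_simps)
      then have "K ((1 / b) *\<^sub>R B x) \<in> closure (K ` cball 0 1)"
        by (intro subsetD[OF closure_subset] imageI)
      moreover have "y = b *\<^sub>R K ((1 / b) *\<^sub>R B x)"
        using b(1) x(2) by (simp add: linear_cmul[OF bounded_linear.linear[OF K]])
      ultimately show "y \<in> (*\<^sub>R) b ` closure (K ` cball 0 1)" by blast
    qed
  qed
qed

section \<open>Powers of bounded operators\<close>

lemma bounded_linear_funpow:
  assumes "bounded_linear (A :: 'a::real_normed_vector \<Rightarrow> 'a)"
  shows "bounded_linear (A ^^ n)"
  by (induction n)
    (auto simp: comp_def id_def bounded_linear_ident intro: bounded_linear_compose[OF assms])

lemma funpow_contracts_invariant: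
  fixes S :: "'a::real_normed_vector \<Rightarrow> 'a"
  assumes "0 \<le> q" and "\<And>x. x \<in> V \<Longrightarrow> S x \<in> V" and "\<And>x. x \<in> V \<Longrightarrow> norm (S x) \<le> q * norm x"
    and "x \<in> V"
  shows "(S ^^ k) x \<in> V \<and> norm ((S ^^ k) x) \<le> q ^ k * norm x"
proof (induction k)
  case 0
  then show ?case using assms(4) by simp
next
  case (Suc k)
  then have "norm (S ((S ^^ k) x)) \<le> q * norm ((S ^^ k) x)"
    using assms(3) by blast
  also have "\<dots> \<le> q * (q ^ k * norm x)"
    using Suc assms(1) by (intro mult_left_mono) auto
  finally show ?case
    using Suc assms(2) by (simp add: mult.assoc)
qed

text \<open>
  Expanding \<open>(A - K) ^ j\<close> gives \<open>A ^ j\<close> and products in which \<open>K\<close> occurs; the latter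
  are compact.
\<close>

lemma power_of_compact_perturbation:
  fixes A K :: "'a::real_normed_vector \<Rightarrow> 'a"
  assumes A: "bounded_linear A" and K: "compact_operator K"
  shows "\<exists>L. compact_operator L \<and> (\<forall>x. ((\<lambda>y. A y - K y) ^^ j) x = (A ^^ j) x - L x)"
proof (induction j)
  case 0
  show ?case by (rule exI[of _ "\<lambda>x. 0"]) (simp add: compact_operator_zero)
next
  case (Suc j)
  let ?D = "\<lambda>y. A y - K y"
  obtain L where L: "compact_operator L" "\<And>x. (?D ^^ j) x = (A ^^ j) x - L x"
    using Suc by blast
  have D: "bounded_linear ?D"
    using A K by (simp add: compact_operator_def bounded_linear_sub)
  let ?L = "\<lambda>x. A (L x) + K ((?D ^^ j) x)"
  have "compact_operator ?L"
    by (intro compact_operator_add compact_operator_compose_left[OF A L(1)]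
        compact_operator_compose_right[OF K bounded_linear_funpow[OF D]])
  moreover have "(?D ^^ Suc j) x = (A ^^ Suc j) x - ?L x" for x
    by (simp add: L(2) linear_diff[OF bounded_linear.linear[OF A]])
  ultimately show ?case by blast
qed

lemma quasi_compact_powers_near_compact:
  assumes "quasi_compact A"
  obtains m a where "m \<ge> (1::nat)" "0 \<le> a" "a < 1"
    "\<And>j. \<exists>L. compact_operator L \<and> (\<forall>x. norm ((A ^^ (m * j)) x - L x) \<le> a ^ j * norm x)"
proof -
  obtain m K where m: "m \<ge> 1" and K: "compact_operator K"
    and lt: "onorm (\<lambda>x. (A ^^ m) x - K x) < 1" and A: "bounded_linear A"
    using assms unfolding quasi_compact_def by blast
  let ?D = "\<lambda>x. (A ^^ m) x - K x"
  have Am: "bounded_linear (A ^^ m)"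
    using A by (rule bounded_linear_funpow)
  have D: "bounded_linear ?D"
    using Am K by (simp add: compact_operator_def bounded_linear_sub)
  have "\<exists>L. compact_operator L \<and> (\<forall>x. norm ((A ^^ (m * j)) x - L x) \<le> onorm ?D ^ j * norm x)"
    for j
  proof -
    obtain L where L: "compact_operator L" "\<And>x. (?D ^^ j) x = ((A ^^ m) ^^ j) x - L x"
      using power_of_compact_perturbation[OF Am K] by blast
    have "norm ((?D ^^ j) x) \<le> onorm ?D ^ j * norm x" for x
      using funpow_contracts_invariant[of "onorm ?D" UNIV ?D x j] onorm[OF D] onorm_pos_le[OF D]
      by simp
    then show ?thesis
      using L by (auto simp: funpow_mult mult.commute)
  qed
  then show thesis
    using that m lt onorm_pos_le[OF D] by blast
qed

section \<open>Markov operators are contractions\<close>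

text \<open>
  The set whose infimum is the base norm of \<open>x\<close> is nonempty: if \<open>x = y - z\<close> with \<open>y\<close>
  and \<open>z\<close> positive, then \<open>f y + f z\<close> belongs to it. For \<open>x = 0\<close> this could fail, namely
  in the zero space, where there are no states.
\<close>

lemma base_gauge_nonempty:
  fixes x :: "'a::{banach,ordered_real_vector}"
  assumes S: "abstract_state_space f" and "x \<noteq> 0"
  shows "\<exists>t u. 0 \<le> t \<and> u \<in> convex hull (state_base f \<union> uminus ` state_base f) \<and> x = t *\<^sub>R u"
proof -
  let ?B = "state_base f \<union> uminus ` state_base f"
  have f: "linear f" and pos: "\<And>x. x > 0 \<Longrightarrow> f x > 0"
    using S by (auto simp: abstract_state_space_def)
  obtain y z where yz: "0 \<le> y" "0 \<le> z" "x = y - z"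
    using S unfolding abstract_state_space_def by metis
  have normalize: "(1 / f v) *\<^sub>R v \<in> state_base f \<and> v = f v *\<^sub>R ((1 / f v) *\<^sub>R v) \<and> f v > 0"
    if "0 \<le> v" "v \<noteq> 0" for v
  proof -
    have "f v > 0" using that pos by (simp add: order_less_le)
    then show ?thesis
      using that by (simp add: state_base_def linear_cmul[OF f] scaleR_nonneg_nonneg)
  qed
  consider "y = 0" "z \<noteq> 0" | "y \<noteq> 0" "z = 0" | "y \<noteq> 0" "z \<noteq> 0"
    using yz(3) \<open>x \<noteq> 0\<close> by auto
  then show ?thesis
  proof cases
    case 1
    note n = normalize[OF yz(2) 1(2)]
    have "- ((1 / f z) *\<^sub>R z) \<in> convex hull ?B"
      using n by (intro hull_inc) blast
    moreover have "x = f z *\<^sub>R (- ((1 / f z) *\<^sub>R z))"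
      using n yz(3) 1 by simp
    ultimately show ?thesis using n less_imp_le by blast
  next
    case 2
    note n = normalize[OF yz(1) 2(1)]
    have "(1 / f y) *\<^sub>R y \<in> convex hull ?B"
      using n by (intro hull_inc) blast
    moreover have "x = f y *\<^sub>R ((1 / f y) *\<^sub>R y)"
      using n yz(3) 2 by simp
    ultimately show ?thesis using n less_imp_le by blast
  next
    case 3
    let ?a = "(1 / f y) *\<^sub>R y" and ?b = "- ((1 / f z) *\<^sub>R z)" and ?t = "f y + f z"
    have n: "?a \<in> state_base f" "f y > 0" "(1 / f z) *\<^sub>R z \<in> state_base f" "f z > 0"
      using normalize[OF yz(1) 3(1)] normalize[OF yz(2) 3(2)] by auto
    have "?a \<in> convex hull ?B" "?b \<in> convex hull ?B"
      using n by (blast intro: hull_inc)+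
    then have "(f y / ?t) *\<^sub>R ?a + (f z / ?t) *\<^sub>R ?b \<in> convex hull ?B"
      using n by (intro convexD[OF convex_convex_hull]) (auto simp: add_divide_distrib[symmetric])
    moreover have "x = ?t *\<^sub>R ((f y / ?t) *\<^sub>R ?a + (f z / ?t) *\<^sub>R ?b)"
      using n yz(3) by (simp add: scaleR_add_right scaleR_diff_right)
    ultimately show ?thesis
      using n by (intro exI[of _ ?t]) (auto intro: less_imp_le)
  qed
qed

lemma markov_norm_le:
  fixes x :: "'a::{banach,ordered_real_vector}"
  assumes S: "abstract_state_space f" and T: "markov f T"
  shows "norm (T x) \<le> norm x"
proof (cases "x = 0")
  case True
  then show ?thesis using T by (simp add: markov_def linear_0)
next
  case False
  let ?B = "state_base f \<union> uminus ` state_base f"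
  let ?G = "\<lambda>x. {t. 0 \<le> t \<and> x \<in> (\<lambda>u. t *\<^sub>R u) ` (convex hull ?B)}"
  have lin: "linear T" and TK: "T ` state_base f \<subseteq> state_base f"
    using T by (auto simp: markov_def)
  have "T ` ?B \<subseteq> ?B"
    using TK by (auto simp: linear_neg[OF lin])
  then have U: "T ` (convex hull ?B) \<subseteq> convex hull ?B"
    unfolding convex_hull_linear_image[OF lin] by (rule hull_mono)
  have "?G x \<subseteq> ?G (T x)"
  proof
    fix t assume "t \<in> ?G x"
    then obtain u where t: "0 \<le> t" "u \<in> convex hull ?B" "x = t *\<^sub>R u"
      by blast
    show "t \<in> ?G (T x)"
      unfolding t(3) linear_cmul[OF lin] using U t(1,2) by blast
  qed
  moreover have "?G x \<noteq> {}"
    using base_gauge_nonempty[OF S False] by blast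
  moreover have "bdd_below (?G (T x))"
    by (rule bdd_belowI[of _ 0]) auto
  ultimately have "base_seminorm f (T x) \<le> base_seminorm f x"
    unfolding base_seminorm_def by (intro cInf_superset_mono) auto
  then show ?thesis
    using S by (simp add: abstract_state_space_def)
qed

section \<open>Decay on the kernel of the projection\<close>

lemma norm_le_ergodicity_coeff:
  assumes "bounded_linear S" and "P x = 0"
  shows "norm (S x) \<le> ergodicity_coeff P S * norm x"
proof (cases "x = 0")
  case True
  then show ?thesis using assms by (simp add: linear_0 bounded_linear.linear)
next
  case False
  let ?R = "{norm (S x) / norm x | x. P x = 0 \<and> x \<noteq> 0}"
  have "bdd_above ?R"
    using onorm[OF assms(1)] by (intro bdd_aboveI[of _ "onorm S"]) (auto simp: pos_divide_le_eq)
  then have "norm (S x) / norm x \<le> Sup ?R"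
    using assms(2) False by (intro cSup_upper) auto
  moreover have "P \<noteq> id"
    using assms(2) False by auto
  ultimately show ?thesis
    using False by (simp add: ergodicity_coeff_def divide_simps)
qed

theorem theorem3p14:
  fixes f :: "'a::{banach,ordered_real_vector} \<Rightarrow> real"
    and P T :: "'a \<Rightarrow> 'a"
  assumes "abstract_state_space f"
    and "is_projection P"
    and "T \<in> markov_commuting f P"
    and "quasi_compact (T \<circ> P)"
    and "\<exists>n0\<ge>1. ergodicity_coeff P (T ^^ n0) < 1"
  shows "quasi_compact T"
proof -
  have mk: "markov f T" and comm: "\<And>x. T (P x) = P (T x)"
    using assms(3) by (auto simp: markov_commuting_def fun_eq_iff)
  have P: "bounded_linear P" and PP: "\<And>x. P (P x) = P x"
    using assms(2) by (auto simp: is_projection_def fun_eq_iff)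
  have T: "bounded_linear T"
    using mk markov_norm_le[OF assms(1) mk]
    by (intro bounded_linear_intro[where K = 1])
      (auto simp: markov_def linear_add linear_cmul)
  have commn: "(T ^^ n) (P x) = P ((T ^^ n) x)" for n x
    by (induction n) (auto simp: comm)
  have TPn: "((T \<circ> P) ^^ n) x = (T ^^ n) (P x)" if "n \<ge> 1" for n x
    using that
  proof (induction n rule: nat_induct_at_least)
    case (Suc n)
    then show ?case by (simp add: commn PP)
  qed simp
  obtain n0 where n0: "n0 \<ge> 1" "ergodicity_coeff P (T ^^ n0) < 1"
    using assms(5) by blast
  \<comment> \<open>Taken nonnegative so that the bound can be iterated.\<close>
  define q where "q = max 0 (ergodicity_coeff P (T ^^ n0))"
  have q: "0 \<le> q" "q < 1"
    using n0 by (auto simp: q_def)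
  have "norm ((T ^^ n0) x) \<le> q * norm x" if "P x = 0" for x
    using norm_le_ergodicity_coeff[of "T ^^ n0" P x] bounded_linear_funpow[OF T] that
      mult_right_mono[of "ergodicity_coeff P (T ^^ n0)" q "norm x"] by (simp add: q_def)
  moreover have "P ((T ^^ n0) x) = 0" if "P x = 0" for x
    unfolding commn[symmetric] that
    by (rule linear_0[OF bounded_linear.linear[OF bounded_linear_funpow[OF T]]])
  ultimately have "norm (((T ^^ n0) ^^ k) x) \<le> q ^ k * norm x" if "P x = 0" for k x
    using funpow_contracts_invariant[of q "{x. P x = 0}" "T ^^ n0" x k] q(1) that by simp
  then have decay: "norm ((T ^^ (n0 * k)) x) \<le> q ^ k * norm x" if "P x = 0" for k x
    using that by (simp add: funpow_mult mult.commute)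
  obtain m a where m: "m \<ge> 1" and a: "0 \<le> a" "a < 1"
    and near: "\<And>j. \<exists>L. compact_operator L \<and>
      (\<forall>x. norm (((T \<circ> P) ^^ (m * j)) x - L x) \<le> a ^ j * norm x)"
    using quasi_compact_powers_near_compact[OF assms(4)] by metis
  have Q: "bounded_linear (\<lambda>x. x - P x)"
    using P by (intro bounded_linear_sub bounded_linear_ident)
  define c where "c = onorm (\<lambda>x. x - P x)"
  have c: "norm (x - P x) \<le> c * norm x" for x
    unfolding c_def by (rule onorm[OF Q])
  have c0: "0 \<le> c"
    unfolding c_def by (rule onorm_pos_le[OF Q])
  have "(\<lambda>j. a ^ j + q ^ j * c) \<longlonglongrightarrow> 0 + 0 * c"
    using a q by (intro tendsto_intros LIMSEQ_power_zero) auto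
  then have "\<forall>\<^sub>F j in sequentially. a ^ j + q ^ j * c < 1"
    by (intro order_tendstoD(2)) auto
  then have "\<forall>\<^sub>F j in sequentially. a ^ j + q ^ j * c < 1 \<and> j \<ge> 1"
    by (intro eventually_conj eventually_ge_at_top)
  then obtain j where j: "a ^ j + q ^ j * c < 1" "j \<ge> 1"
    using eventually_happens'[OF sequentially_bot] by blast
  define N where "N = m * (n0 * j)"
  have N: "N \<ge> 1"
    using m n0(1) j(2) by (simp add: N_def Suc_le_eq)
  obtain L where L: "compact_operator L"
    and LN: "\<And>x. norm (((T \<circ> P) ^^ N) x - L x) \<le> a ^ (n0 * j) * norm x"
    unfolding N_def using near[of "n0 * j"] by blast
  have "norm ((T ^^ N) x - L x) \<le> (a ^ j + q ^ j * c) * norm x" for x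
  proof -
    have split: "(T ^^ N) x - L x = (((T \<circ> P) ^^ N) x - L x) + (T ^^ N) (x - P x)"
      by (simp add: TPn[OF N] linear_diff[OF bounded_linear.linear[OF bounded_linear_funpow[OF T]]])
    have "norm (((T \<circ> P) ^^ N) x - L x) \<le> a ^ (n0 * j) * norm x"
      by (rule LN)
    also have "\<dots> \<le> a ^ j * norm x"
      using a n0(1) by (intro mult_right_mono power_decreasing) auto
    finally have 1: "norm (((T \<circ> P) ^^ N) x - L x) \<le> a ^ j * norm x" .
    have "P (x - P x) = 0"
      by (simp add: PP linear_diff[OF bounded_linear.linear[OF P]])
    then have "norm ((T ^^ N) (x - P x)) \<le> q ^ (m * j) * norm (x - P x)"
      using decay[of "x - P x" "m * j"] by (simp add: N_def ac_simps)
    also have "\<dots> \<le> q ^ j * (c * norm x)"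
      using q m c by (intro mult_mono power_decreasing) auto
    finally have 2: "norm ((T ^^ N) (x - P x)) \<le> q ^ j * (c * norm x)" .
    show ?thesis
      unfolding split using norm_triangle_le[OF add_mono[OF 1 2]] by (simp add: algebra_simps)
  qed
  then have "onorm (\<lambda>x. (T ^^ N) x - L x) \<le> a ^ j + q ^ j * c"
    using a q c0 by (intro onorm_bound) auto
  then have "onorm (\<lambda>x. (T ^^ N) x - L x) < 1"
    using j(1) by linarith
  then show ?thesis
    unfolding quasi_compact_def using T N L by blast
qed

end
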